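(* Let $x_1<x_2<x_3$ be real constants with $x_1+x_2+x_3=0$, and define $$f(s)=x_1+(x_2-x_1)\,\mathrm{sn}^2\!\left(\frac{\sqrt{x_3-x_1}}{2}\,s,\ \sqrt{\frac{x_2-x_1}{x_3-x_1}}\right).$$ Then the second order differential equation $$\psi_{ss}-\frac{\psi_s^2+1}{2\psi}-f(s)\,\psi=0$$ admits the solution $\psi=\psi(s)$ given by $$(-c_1+c_2\cos\theta+c_3\sin\theta)\,\psi=f(s),\qquad \theta=\theta(s)=\int_0^s\frac{dt}{\psi(t)},$$ where the integral constants $c_1,c_2,c_3$ satisfy $-c_1^2+c_2^2+c_3^2=-x_1x_2x_3$.
   Context: $\mathrm{sn}(u,k)$ denotes the Jacobi elliptic sine function with modulus $k$, i.e. $\mathrm{sn}(u,k)=\sin\varphi$ where $u=\int_0^\varphi\frac{d\vartheta}{\sqrt{1-k^2\sin^2\vartheta}}$. The relation for $\psi$ is implicit, since $\theta$ depends on $\psi$; the unknown $\psi$ is a non-vanishing smooth function of $s$. *)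

theory Defs
  imports "HOL-Analysis.Analysis"
begin

text \<open>
  The integrals \<open>LBINT t=a..b. _\<close> are oriented, so negative upper limits are handled correctly.
\<close>

definition elliptic_F :: "real \<Rightarrow> real \<Rightarrow> real" where
  "elliptic_F \<phi> k = (LBINT t=ereal 0..ereal \<phi>. 1 / sqrt (1 - k\<^sup>2 * (sin t)\<^sup>2))"

text \<open>
  For \<open>0 \<le> k < 1\<close> the map \<open>\<phi> \<mapsto> elliptic_F \<phi> k\<close> is an increasing bijection of the reals, so the
  description below denotes the unique amplitude. The second argument is the modulus \<open>k\<close>, not the
  parameter \<open>m = k\<^sup>2\<close>.
\<close>

definition jacobi_am :: "real \<Rightarrow> real \<Rightarrow> real" where
  "jacobi_am u k = (THE \<phi>. elliptic_F \<phi> k = u)"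

definition jacobi_sn :: "real \<Rightarrow> real \<Rightarrow> real" where
  "jacobi_sn u k = sin (jacobi_am u k)"

definition sn_potential :: "real \<Rightarrow> real \<Rightarrow> real \<Rightarrow> real \<Rightarrow> real" where
  "sn_potential x1 x2 x3 s =
     x1 + (x2 - x1) * (jacobi_sn (sqrt (x3 - x1) / 2 * s) (sqrt ((x2 - x1) / (x3 - x1))))\<^sup>2"

text \<open>Infinite differentiability; meant for open \<open>I\<close>, where \<open>deriv\<close> is determined by \<open>f\<close> on \<open>I\<close>.\<close>

definition smooth_on_open :: "real set \<Rightarrow> (real \<Rightarrow> real) \<Rightarrow> bool" where
  "smooth_on_open I f \<longleftrightarrow> open I \<and> (\<forall>n. (deriv ^^ n) f differentiable_on I)"

definition theta :: "(real \<Rightarrow> real) \<Rightarrow> real \<Rightarrow> real" where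
  "theta \<psi> s = (LBINT t=ereal 0..ereal s. 1 / \<psi> t)"

text \<open>
  \<open>\<psi>\<close> is a non-vanishing smooth function on the open interval \<open>I\<close>, which contains the base point
  \<open>0\<close> of the integral \<open>theta\<close>, and satisfies the implicit relation there.
\<close>

definition implicit_relation ::
  "(real \<Rightarrow> real) \<Rightarrow> real \<Rightarrow> real \<Rightarrow> real \<Rightarrow> real set \<Rightarrow> (real \<Rightarrow> real) \<Rightarrow> bool" where
  "implicit_relation f c1 c2 c3 I \<psi> \<longleftrightarrow>
     is_interval I \<and> 0 \<in> I \<and> smooth_on_open I \<psi> \<and> (\<forall>s\<in>I. \<psi> s \<noteq> 0) \<and>
     (\<forall>s\<in>I. (- c1 + c2 * cos (theta \<psi> s) + c3 * sin (theta \<psi> s)) * \<psi> s = f s)"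

definition solves_ode_on :: "(real \<Rightarrow> real) \<Rightarrow> real set \<Rightarrow> (real \<Rightarrow> real) \<Rightarrow> bool" where
  "solves_ode_on f I \<psi> \<longleftrightarrow>
     (\<forall>s\<in>I. deriv (deriv \<psi>) s - ((deriv \<psi> s)\<^sup>2 + 1) / (2 * \<psi> s) - f s * \<psi> s = 0)"

end

(*
  Put G = - c1 + c2 cos theta + c3 sin theta and H = - c2 sin theta + c3 cos theta.  The potential
  satisfies f'^2 = (f - x1)(f - x2)(f - x3), and H^2 + (G + c1)^2 = c2^2 + c3^2.  Differentiating
  G psi = f twice, with theta' = 1 / psi, and eliminating H gives
    G^2 (2 psi psi'' - psi'^2 - 1 - 2 f psi^2) = x1 x2 x3 + (- c1^2 + c2^2 + c3^2) = 0,
  so the equation holds wherever f, and hence G, does not vanish.  The zeros of f are isolated, so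
  continuity gives the equation everywhere.
  For existence, separate variables in theta' = G(theta) / f: theta is obtained from the integral
  of 1 / f by inverting the integral of 1 / G, and psi = f / G(theta).
*)
theory Submission
  imports Defs
begin

section \<open>Differentiating an oriented integral in its upper limit\<close>

lemma interval_integral_has_real_derivative:
  fixes f :: "real \<Rightarrow> real"
  assumes "open I" "is_interval I" "c \<in> I" "s \<in> I" "continuous_on I f"
  shows "((\<lambda>u. LBINT t=ereal c..ereal u. f t) has_real_derivative f s) (at s)"
proof -
  \<comment> \<open>The fundamental theorem is applied on a closed interval and yields a derivative
    within it. Widening the span of \<open>c\<close> and \<open>s\<close> on both sides makes
    \<open>s\<close> interior, so the restriction disappears.\<close>
  have "min c s \<in> I" "max c s \<in> I"
    using assms by (auto simp: min_def max_def)
  then obtain d e where d: "0 < d" "cball (min c s) d \<subseteq> I" and e: "0 < e" "cball (max c s) e \<subseteq> I"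
    using assms(1) unfolding open_contains_cball by blast
  define a b where "a = min c s - d" and "b = max c s + e"
  then have "a \<in> cball (min c s) d" "b \<in> cball (max c s) e"
    using d(1) e(1) by (simp_all add: dist_real_def)
  then have ab: "a \<in> I" "b \<in> I"
    using d(2) e(2) by blast+
  have a: "a < min c s" and b: "max c s < b"
    unfolding a_def b_def using d(1) e(1) by linarith+
  have sub: "{a..b} \<subseteq> I"
    using mem_is_interval_1_I[OF assms(2) ab] by auto
  have "((\<lambda>u. LBINT t=ereal c..ereal u. f t) has_vector_derivative f s) (at s within {a..b})"
    by (rule interval_integral_FTC2[OF _ _ continuous_on_subset[OF assms(5) sub]]) (use a b in simp_all)
  moreover have "at s within {a..b} = at s"
    by (rule at_within_Icc_at) (use a b in simp_all)
  ultimately show ?thesis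
    by (simp add: has_real_derivative_iff_has_vector_derivative)
qed

section \<open>Inverting the integral of a reciprocal\<close>

context
  fixes g :: "real \<Rightarrow> real" and M :: real
  assumes g_cont: "continuous_on UNIV g"
    and g_pos: "\<And>x. 0 < g x" and g_le: "\<And>x. g x \<le> M"
begin

text \<open>The time needed from 0 to \<open>x\<close> by a point moving with velocity
  \<open>g\<close>; its inverse is the solution of y' = g(y) starting at 0.\<close>

private definition travel_time :: "real \<Rightarrow> real" where
  "travel_time x = (LBINT t=ereal 0..ereal x. 1 / g t)"

lemma DERIV_travel_time: "(travel_time has_real_derivative 1 / g x) (at x)"
proof -
  have "g t \<noteq> 0" for t using g_pos[of t] by simp
  then have "continuous_on UNIV (\<lambda>t. 1 / g t)"
    by (intro continuous_on_divide continuous_on_const g_cont) auto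
  from interval_integral_has_real_derivative[OF open_UNIV _ _ _ this] show ?thesis
    by (simp add: travel_time_def[abs_def] is_interval_univ)
qed

lemma travel_time_strict_mono: "x < y \<Longrightarrow> travel_time x < travel_time y"
  by (erule DERIV_pos_imp_increasing) (intro exI conjI, rule DERIV_travel_time, simp add: g_pos)

lemma travel_time_0: "travel_time 0 = 0"
  by (simp add: travel_time_def)

text \<open>Velocity at most \<open>M\<close> gives slope at least \<open>1 / M\<close>, so the
  travel time is unbounded in both directions and the intermediate value theorem applies.\<close>

lemma travel_time_surj: "\<exists>x. travel_time x = u"
proof -
  have M: "0 < M" using g_pos[of 0] g_le[of 0] by linarith
  have grow: "(y - x) / M \<le> travel_time y - travel_time x" if "x \<le> y" for x y
  proof -
    have "travel_time x - x / M \<le> travel_time y - y / M"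
    proof (rule DERIV_nonneg_imp_nondecreasing[OF that], intro exI conjI)
      fix z
      show "((\<lambda>x. travel_time x - x / M) has_real_derivative 1 / g z - 1 / M) (at z)"
        by (intro DERIV_diff DERIV_cdivide DERIV_travel_time DERIV_ident)
      show "0 \<le> 1 / g z - 1 / M"
        using frac_le[of 1 1 "g z" M] g_pos[of z] g_le[of z] by simp
    qed
    then show ?thesis by (simp add: diff_divide_distrib)
  qed
  have cont: "continuous_on A travel_time" for A
    by (meson DERIV_travel_time DERIV_isCont continuous_at_imp_continuous_on)
  \<comment> \<open>Covering the distance \<open>m\<close> takes at least the time
    \<open>\<bar>u\<bar>\<close>, even at top speed \<open>M\<close>; so \<open>u\<close> lies
    between the travel times at \<open>-m\<close> and \<open>m\<close>.\<close>
  define m where "m = M * \<bar>u\<bar>"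
  have m: "0 \<le> m" "m / M = \<bar>u\<bar>" using M by (auto simp: m_def)
  have "\<exists>x. -m \<le> x \<and> x \<le> m \<and> travel_time x = u"
    by (rule IVT') (use grow[of 0 m] grow[of "-m" 0] m travel_time_0 cont in auto)
  then show ?thesis by blast
qed

lemma travel_time_The: "travel_time (THE x. travel_time x = u) = u"
  by (rule theI') (metis travel_time_surj travel_time_strict_mono linorder_neqE less_irrefl)

lemma The_travel_time: "(THE x. travel_time x = travel_time y) = y"
  by (rule the_equality) (metis travel_time_strict_mono linorder_neqE less_irrefl)+

text \<open>The inverse function theorem turns the slope \<open>1 / g\<close> into \<open>g\<close>.
  This serves twice: for the Jacobi amplitude, and for separating variables in the existence
  proof.\<close>

lemma inverse_integral_DERIV:
  defines "a \<equiv> \<lambda>u. THE x. (LBINT t=ereal 0..ereal x. 1 / g t) = u"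
  shows "a 0 = 0" "(a has_real_derivative g (a u)) (at u)"
proof -
  have a: "a = (\<lambda>u. THE x. travel_time x = u)"
    by (simp add: a_def travel_time_def)
  show "a 0 = 0"
    using The_travel_time[of 0] by (simp add: a travel_time_0)
  have "(travel_time has_derivative (*) (1 / g (a u))) (at (a u))"
    using DERIV_travel_time by (simp add: has_field_derivative_def)
  moreover have "(*) (1 / g (a u)) \<circ> (*) (g (a u)) = id"
    using g_pos[of "a u"] by (auto simp: fun_eq_iff)
  moreover have "continuous_on UNIV travel_time"
    by (meson DERIV_travel_time DERIV_isCont continuous_at_imp_continuous_on)
  ultimately have "(a has_derivative (*) (g (a u))) (at (travel_time (a u)))"
    by (intro has_derivative_inverse_strong[where S = UNIV and f = travel_time])
       (auto simp: a The_travel_time)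
  then show "(a has_real_derivative g (a u)) (at u)"
    by (simp add: a travel_time_The has_field_derivative_def)
qed

end

section \<open>The Jacobi amplitude and the differential equations of the potential\<close>

lemma jacobi_am_DERIV:
  assumes "k\<^sup>2 < 1"
  shows "jacobi_am 0 k = 0"
    and "((\<lambda>u. jacobi_am u k) has_real_derivative sqrt (1 - k\<^sup>2 * (sin (jacobi_am u k))\<^sup>2)) (at u)"
proof -
  let ?g = "\<lambda>t. sqrt (1 - k\<^sup>2 * (sin t)\<^sup>2)"
  have s: "(sin t)\<^sup>2 \<le> 1" for t :: real
    by (simp add: abs_square_le_1)
  have "k\<^sup>2 * (sin t)\<^sup>2 < 1" for t
    using mult_left_mono[OF s, of "k\<^sup>2" t] assms by simp
  then have g: "continuous_on UNIV ?g" "\<And>t. 0 < ?g t" "\<And>t. ?g t \<le> 1"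
    by (auto intro!: continuous_intros)
  show "jacobi_am 0 k = 0"
    using inverse_integral_DERIV(1)[OF g] by (simp add: jacobi_am_def elliptic_F_def)
  show "((\<lambda>u. jacobi_am u k) has_real_derivative ?g (jacobi_am u k)) (at u)"
    using inverse_integral_DERIV(2)[OF g] by (simp add: jacobi_am_def elliptic_F_def)
qed

text \<open>Writing f for the potential, f - x1, x2 - f and x3 - f are constant multiples of sn^2,
  cn^2 and dn^2. Hence f'^2 is a cubic in f with roots x1, x2, x3, whose quadratic term vanishes by
  the zero sum. The second derivative is computed directly, since differentiating the square would
  require division by \<open>d\<close>, which has zeros.\<close>

lemma sn_potential_DERIV:
  fixes x1 x2 x3 :: real
  assumes "x1 < x2" "x2 < x3" "x1 + x2 + x3 = 0"
  defines "p \<equiv> x1 * x2 + x2 * x3 + x3 * x1"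
  obtains d where
    "\<And>s. (sn_potential x1 x2 x3 has_real_derivative d s) (at s)"
    "\<And>s. (d has_real_derivative (3 * (sn_potential x1 x2 x3 s)\<^sup>2 + p) / 2) (at s)"
    "\<And>s. (d s)\<^sup>2 = (sn_potential x1 x2 x3 s)^3 + p * sn_potential x1 x2 x3 s - x1 * x2 * x3"
    "sn_potential x1 x2 x3 0 = x1"
proof -
  define w where "w = sqrt (x3 - x1) / 2"
  define k where "k = sqrt ((x2 - x1) / (x3 - x1))"
  define a where "a s = jacobi_am (w * s) k" for s
  \<comment> \<open>This is dn, while \<open>sin (a s)\<close> and \<open>cos (a s)\<close> are sn
    and cn.\<close>
  define \<Delta> where "\<Delta> s = sqrt (1 - k\<^sup>2 * (sin (a s))\<^sup>2)" for s
  define f where "f = sn_potential x1 x2 x3"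
  have w2: "4 * w\<^sup>2 = x3 - x1" using assms by (simp add: w_def power_divide)
  have k2: "k\<^sup>2 = (x2 - x1) / (x3 - x1)" using assms by (simp add: k_def)
  have k: "k\<^sup>2 < 1" using assms by (simp add: k2)
  have "(sin (a s))\<^sup>2 \<le> 1" for s by (simp add: abs_square_le_1)
  then have "k\<^sup>2 * (sin (a s))\<^sup>2 < 1" for s
    using mult_left_mono[of "(sin (a s))\<^sup>2" 1 "k\<^sup>2"] k by (metis mult.right_neutral order.strict_trans1 zero_le_power2)
  then have \<Delta>: "0 < \<Delta> s" "(\<Delta> s)\<^sup>2 = 1 - k\<^sup>2 * (sin (a s))\<^sup>2" for s
    by (auto simp: \<Delta>_def less_imp_le)
  have da: "(a has_real_derivative \<Delta> s * w) (at s)" for s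
  proof -
    have "((\<lambda>s. w * s) has_real_derivative w) (at s)"
      by (auto intro!: derivative_eq_intros)
    from DERIV_chain2[OF jacobi_am_DERIV(2)[OF k] this] show ?thesis
      by (simp add: a_def[abs_def] \<Delta>_def)
  qed
  have d\<Delta>: "(\<Delta> has_real_derivative - k\<^sup>2 * sin (a s) * cos (a s) * w) (at s)" for s
  proof -
    have "((\<lambda>s. 1 - k\<^sup>2 * (sin (a s))\<^sup>2) has_real_derivative
        - k\<^sup>2 * (2 * sin (a s) * cos (a s) * (\<Delta> s * w))) (at s)"
      by (rule derivative_eq_intros da refl | simp)+
    moreover have "0 < 1 - k\<^sup>2 * (sin (a s))\<^sup>2" using \<Delta>(1)[of s] by (simp add: \<Delta>_def)
    ultimately have "(\<Delta> has_real_derivative inverse (\<Delta> s) / 2 *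
        (- k\<^sup>2 * (2 * sin (a s) * cos (a s) * (\<Delta> s * w)))) (at s)"
      unfolding \<Delta>_def[abs_def] by (intro DERIV_chain2[OF DERIV_real_sqrt])
    then show ?thesis using \<Delta>(1)[of s] by (simp add: field_simps)
  qed
  have f: "f s = x1 + (x2 - x1) * (sin (a s))\<^sup>2" for s
    by (simp add: f_def sn_potential_def jacobi_sn_def a_def w_def k_def)
  define d where "d s = 2 * (x2 - x1) * w * sin (a s) * cos (a s) * \<Delta> s" for s
  have fs: "(sin (a s))\<^sup>2 = (f s - x1) / (x2 - x1)" "(cos (a s))\<^sup>2 = (x2 - f s) / (x2 - x1)"
     "(\<Delta> s)\<^sup>2 = (x3 - f s) / (x3 - x1)" for s
  proof -
    show *: "(sin (a s))\<^sup>2 = (f s - x1) / (x2 - x1)" using assms by (simp add: f)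
    show "(cos (a s))\<^sup>2 = (x2 - f s) / (x2 - x1)"
      using assms by (simp add: cos_squared_eq * field_simps)
    have "k\<^sup>2 * (sin (a s))\<^sup>2 = (f s - x1) / (x3 - x1)"
      using assms(1,2) by (simp add: k2 *)
    then show "(\<Delta> s)\<^sup>2 = (x3 - f s) / (x3 - x1)"
      using assms(1,2) by (simp add: \<Delta>(2) field_simps)
  qed
  have x3: "x3 = - x1 - x2" using assms by linarith
  have 1: "(f has_real_derivative d s) (at s)" for s
    unfolding f[abs_def] d_def
    by (rule derivative_eq_intros da refl | simp)+
  have 2: "(d has_real_derivative (3 * (f s)\<^sup>2 + p) / 2) (at s)" for s
  proof -
    have "(d has_real_derivative 2 * (x2 - x1) * w\<^sup>2 *
       (((cos (a s))\<^sup>2 - (sin (a s))\<^sup>2) * (\<Delta> s)\<^sup>2 - k\<^sup>2 * (sin (a s))\<^sup>2 * (cos (a s))\<^sup>2)) (at s)"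
      unfolding d_def[abs_def]
      by (rule derivative_eq_intros da d\<Delta> refl)+ (simp add: algebra_simps power2_eq_square)
    also have "2 * (x2 - x1) * w\<^sup>2 *
       (((cos (a s))\<^sup>2 - (sin (a s))\<^sup>2) * (\<Delta> s)\<^sup>2 - k\<^sup>2 * (sin (a s))\<^sup>2 * (cos (a s))\<^sup>2)
      = (3 * (f s)\<^sup>2 + p) / 2"
    proof -
      \<comment> \<open>The factor 4 turns \<open>w\<^sup>2\<close> into \<open>x3 - x1\<close>,
        which cancels the denominators coming from \<open>fs\<close> and \<open>k2\<close>.\<close>
      have "4 * (2 * (x2 - x1) * w\<^sup>2 *
         (((cos (a s))\<^sup>2 - (sin (a s))\<^sup>2) * (\<Delta> s)\<^sup>2 - k\<^sup>2 * (sin (a s))\<^sup>2 * (cos (a s))\<^sup>2))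
        = 2 * (x2 - x1) * (x3 - x1) * (((x2 - f s) / (x2 - x1) - (f s - x1) / (x2 - x1)) * ((x3 - f s) / (x3 - x1))
            - (x2 - x1) / (x3 - x1) * ((f s - x1) / (x2 - x1)) * ((x2 - f s) / (x2 - x1)))"
        unfolding fs k2 w2[symmetric] by (simp add: algebra_simps)
      also have "\<dots> = 2 * ((x2 - f s - (f s - x1)) * (x3 - f s) - (f s - x1) * (x2 - f s))"
        using assms by (simp add: divide_simps) (simp add: algebra_simps)
      \<comment> \<open>The term linear in f carries the factor x1 + x2 + x3 and drops out.\<close>
      also have "\<dots> = 4 * ((3 * (f s)\<^sup>2 + p) / 2)"
        unfolding p_def x3 by (simp add: algebra_simps power2_eq_square)
      finally show ?thesis by linarith
    qed
    finally show ?thesis .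
  qed
  have 3: "(d s)\<^sup>2 = (f s)^3 + p * f s - x1 * x2 * x3" for s
  proof -
    have "(d s)\<^sup>2 = (x2 - x1)\<^sup>2 * (4 * w\<^sup>2) * (sin (a s))\<^sup>2 * (cos (a s))\<^sup>2 * (\<Delta> s)\<^sup>2"
      unfolding d_def by algebra
    also have "\<dots> = (f s - x1) * (x2 - f s) * (x3 - f s)"
      unfolding fs w2 using assms by (simp add: divide_simps) (simp add: algebra_simps power2_eq_square)
    also have "\<dots> = (f s)^3 + p * f s - x1 * x2 * x3"
      unfolding p_def x3 by (simp add: algebra_simps power2_eq_square power3_eq_cube)
    finally show ?thesis .
  qed
  have "f 0 = x1"
    using jacobi_am_DERIV(1)[OF k] by (simp add: f a_def)
  with 1 2 3 show ?thesis using that unfolding f_def by blast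
qed

section \<open>From the implicit relation to the differential equation\<close>

lemma eventually_neq_of_DERIV:
  fixes f :: "real \<Rightarrow> real"
  assumes "(f has_real_derivative D) (at s)" "D \<noteq> 0"
  shows "eventually (\<lambda>t. f t \<noteq> f s) (at s)"
proof -
  have "((\<lambda>t. (f t - f s) / (t - s)) \<longlongrightarrow> D) (at s)"
    using assms(1) by (simp add: has_field_derivative_iff)
  from tendsto_imp_eventually_ne[OF this assms(2)] show ?thesis
    by eventually_elim auto
qed

text \<open>Of the elliptic function only its differential equations are kept. Where f vanishes its
  second derivative is \<open>p / 2\<close>, so \<open>p \<noteq> 0\<close> excludes a common zero
  of f, f' and f''; this isolates the zeros of f.\<close>

lemma implicit_relation_imp_solves_ode:
  fixes f d :: "real \<Rightarrow> real" and p q c1 c2 c3 :: real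
  assumes df: "\<And>s. (f has_real_derivative d s) (at s)"
    and dd: "\<And>s. (d has_real_derivative (3 * (f s)\<^sup>2 + p) / 2) (at s)"
    and d2: "\<And>s. (d s)\<^sup>2 = (f s)^3 + p * f s - q"
    and p: "p \<noteq> 0"
    and c: "- c1\<^sup>2 + c2\<^sup>2 + c3\<^sup>2 = - q"
    and impl: "implicit_relation f c1 c2 c3 I \<psi>"
  shows "solves_ode_on f I \<psi>"
proof -
  define G where "G s = - c1 + c2 * cos (theta \<psi> s) + c3 * sin (theta \<psi> s)" for s
  define H where "H s = - c2 * sin (theta \<psi> s) + c3 * cos (theta \<psi> s)" for s
  define \<psi>1 where "\<psi>1 = deriv \<psi>"
  define \<psi>2 where "\<psi>2 = deriv \<psi>1"
  have I: "is_interval I" "0 \<in> I" "open I" and sm: "\<And>n. (deriv ^^ n) \<psi> differentiable_on I"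
    and nz: "\<And>s. s \<in> I \<Longrightarrow> \<psi> s \<noteq> 0" and rel: "\<And>s. s \<in> I \<Longrightarrow> G s * \<psi> s = f s"
    using impl by (auto simp: implicit_relation_def smooth_on_open_def G_def)
  have D: "((deriv ^^ n) \<psi> has_real_derivative (deriv ^^ Suc n) \<psi> s) (at s)" if "s \<in> I" for n s
    using sm[of n] that I(3)
    by (simp add: DERIV_deriv_iff_real_differentiable differentiable_on_eq_differentiable_at)
  \<comment> \<open>Continuity of \<open>\<psi>2\<close>, obtained from a third derivative, is
    needed for the limit at the zeros of f.\<close>
  have D0: "(\<psi> has_real_derivative \<psi>1 s) (at s)" and D1: "(\<psi>1 has_real_derivative \<psi>2 s) (at s)"
    and C2: "isCont \<psi>2 s" if "s \<in> I" for s
    using D[OF that, of 0] D[OF that, of 1] DERIV_isCont[OF D[OF that, of 2]]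
    by (simp_all add: \<psi>1_def \<psi>2_def eval_nat_numeral)
  have d\<theta>: "(theta \<psi> has_real_derivative 1 / \<psi> s) (at s)" if "s \<in> I" for s
    unfolding theta_def[abs_def]
    by (rule interval_integral_has_real_derivative[OF I(3,1,2) that])
       (use nz in \<open>auto intro!: continuous_intros continuous_at_imp_continuous_on DERIV_isCont[OF D0]\<close>)
  have dG: "(G has_real_derivative H s / \<psi> s) (at s)"
    and dH: "(H has_real_derivative - (G s + c1) / \<psi> s) (at s)" if "s \<in> I" for s
    unfolding G_def[abs_def] H_def[abs_def]
    by ((rule derivative_eq_intros d\<theta>[OF that] refl)+, simp add: field_simps nz[OF that])+
  have first: "d s = H s + G s * \<psi>1 s" if s: "s \<in> I" for s
  proof -
    have "((\<lambda>s. G s * \<psi> s) has_real_derivative H s + G s * \<psi>1 s) (at s)"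
      by (rule derivative_eq_intros dG[OF s] D0[OF s] refl)+ (simp add: nz[OF s])
    then have "(f has_real_derivative H s + G s * \<psi>1 s) (at s)"
      by (rule has_field_derivative_transform_within_open[OF _ I(3) s]) (simp add: rel)
    with df DERIV_unique show ?thesis by blast
  qed
  have second: "(3 * (f s)\<^sup>2 + p) / 2 * \<psi> s = - (G s + c1) + H s * \<psi>1 s + G s * \<psi>2 s * \<psi> s"
    if s: "s \<in> I" for s
  proof -
    have "((\<lambda>s. H s + G s * \<psi>1 s) has_real_derivative
        - (G s + c1) / \<psi> s + (H s / \<psi> s * \<psi>1 s + G s * \<psi>2 s)) (at s)"
      by (rule derivative_eq_intros dG[OF s] dH[OF s] D1[OF s] refl)+ simp
    then have "(d has_real_derivative
        - (G s + c1) / \<psi> s + (H s / \<psi> s * \<psi>1 s + G s * \<psi>2 s)) (at s)"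
      by (rule has_field_derivative_transform_within_open[OF _ I(3) s]) (simp add: first)
    then have "(3 * (f s)\<^sup>2 + p) / 2 = - (G s + c1) / \<psi> s + (H s / \<psi> s * \<psi>1 s + G s * \<psi>2 s)"
      using dd DERIV_unique by blast
    then have "(3 * (f s)\<^sup>2 + p) / 2 * \<psi> s =
        (- (G s + c1) / \<psi> s + (H s / \<psi> s * \<psi>1 s + G s * \<psi>2 s)) * \<psi> s" by simp
    also have "\<dots> = - (G s + c1) + H s * \<psi>1 s + G s * \<psi>2 s * \<psi> s"
      using nz[OF s] by (simp add: distrib_right)
    finally show ?thesis .
  qed
  \<comment> \<open>The left side of the differential equation multiplied by
    \<open>2 * \<psi> s\<close>.\<close>
  define E where "E s = 2 * \<psi> s * \<psi>2 s - (\<psi>1 s)\<^sup>2 - 1 - 2 * f s * (\<psi> s)\<^sup>2" for s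
  have E_nz: "E s = 0" if s: "s \<in> I" and fnz: "f s \<noteq> 0" for s
  proof -
    have G: "G s \<noteq> 0" using rel[OF s] fnz by auto
    have "(H s)\<^sup>2 + (G s + c1)\<^sup>2 = (c2\<^sup>2 + c3\<^sup>2) * ((sin (theta \<psi> s))\<^sup>2 + (cos (theta \<psi> s))\<^sup>2)"
      unfolding H_def G_def by algebra
    then have "(H s)\<^sup>2 + (G s + c1)\<^sup>2 = c2\<^sup>2 + c3\<^sup>2" by simp
    then have HG: "(H s)\<^sup>2 + (G s)\<^sup>2 + 2 * c1 * G s = - q"
      using c by (simp add: power2_sum algebra_simps)
    \<comment> \<open>After multiplication by the square of G, \<open>\<psi>\<close> and its
      derivatives occur only multiplied by G. These products can be replaced using the relation and
      its first two derivatives.\<close>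
    have "(G s)\<^sup>2 * E s = 2 * (G s * \<psi> s) * (G s * \<psi>2 s) - (G s * \<psi>1 s)\<^sup>2 - (G s)\<^sup>2 - 2 * f s * (G s * \<psi> s)\<^sup>2"
      by (simp add: E_def power2_eq_square algebra_simps)
    also have "2 * (G s * \<psi> s) * (G s * \<psi>2 s) = 2 * G s * ((3 * (f s)\<^sup>2 + p) / 2 * \<psi> s + (G s + c1) - H s * \<psi>1 s)"
      using second[OF s] by algebra
    also have "\<dots> = f s * (3 * (f s)\<^sup>2 + p) + 2 * G s * (G s + c1) - 2 * H s * (G s * \<psi>1 s)"
      by (simp add: rel[OF s, symmetric] algebra_simps)
    also have "G s * \<psi>1 s = d s - H s" using first[OF s] by simp
    also have "G s * \<psi> s = f s" by (rule rel[OF s])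
    finally have "(G s)\<^sup>2 * E s = (f s)^3 + p * f s - (d s)\<^sup>2 + ((H s)\<^sup>2 + (G s)\<^sup>2 + 2 * c1 * G s)"
      by (simp add: algebra_simps power2_eq_square power3_eq_cube)
    then show ?thesis using G by (simp add: HG d2)
  qed
  have E: "E s = 0" if s: "s \<in> I" for s
  proof (cases "f s = 0")
    case True
    \<comment> \<open>At a double zero, which forces \<open>q = 0\<close>, the second derivative \<open>p / 2\<close> does not vanish.\<close>
    have "eventually (\<lambda>t. f t \<noteq> 0) (at s)"
    proof (cases "d s = 0")
      case False
      then show ?thesis using eventually_neq_of_DERIV[OF df, of s] True by simp
    next
      case ds: True
      then have "q = 0" using d2[of s] True by simp
      \<comment> \<open>Without constant term, the cubic makes every zero of f a zero of
        \<open>d\<close>, so it suffices to isolate the zeros of \<open>d\<close>.\<close>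
      then have "d t = 0" if "f t = 0" for t using d2[of t] that by simp
      moreover have "eventually (\<lambda>t. d t \<noteq> 0) (at s)"
        using eventually_neq_of_DERIV[OF dd, of s] ds True p by simp
      ultimately show ?thesis by (auto elim: eventually_mono)
    qed
    moreover have "eventually (\<lambda>t. t \<in> I) (at s)"
      using I(3) s by (simp add: eventually_at_in_open')
    ultimately have "eventually (\<lambda>t. E t = 0) (at s)"
      by eventually_elim (rule E_nz)
    then have "(E \<longlongrightarrow> 0) (at s)" by (rule tendsto_eventually)
    moreover have "isCont E s"
      unfolding E_def
      by (intro continuous_intros C2[OF s] DERIV_isCont[OF D0[OF s]] DERIV_isCont[OF D1[OF s]] DERIV_isCont[OF df])
    then have "(E \<longlongrightarrow> E s) (at s)" by (simp add: isCont_def)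
    ultimately show ?thesis using tendsto_unique[OF trivial_limit_at] by blast
  qed (rule E_nz[OF s])
  show ?thesis
    unfolding solves_ode_on_def
  proof
    fix s assume s: "s \<in> I"
    show "deriv (deriv \<psi>) s - ((deriv \<psi> s)\<^sup>2 + 1) / (2 * \<psi> s) - f s * \<psi> s = 0"
      using E[OF s] nz[OF s] unfolding E_def \<psi>1_def \<psi>2_def
      by (simp add: field_simps power2_eq_square)
  qed
qed

section \<open>Smoothness from families closed under differentiation\<close>

text \<open>By induction each iterated \<open>deriv\<close> agrees on \<open>I\<close> with a member
  of the family. Agreement on \<open>I\<close> is enough because \<open>I\<close> is open and
  derivatives are local.\<close>

lemma smooth_on_open_of_derivative_closed:
  assumes "open I" "h \<in> \<A>"
    and closed: "\<And>h. h \<in> \<A> \<Longrightarrow> \<exists>h'\<in>\<A>. \<forall>s\<in>I. (h has_real_derivative h' s) (at s)"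
  shows "smooth_on_open I h"
proof -
  have *: "\<exists>g\<in>\<A>. \<forall>s\<in>I. (deriv ^^ n) h s = g s" for n
  proof (induction n)
    case (Suc n)
    then obtain g where g: "g \<in> \<A>" "\<forall>s\<in>I. (deriv ^^ n) h s = g s" by blast
    from closed[OF g(1)] obtain g' where g': "g' \<in> \<A>" "\<forall>s\<in>I. (g has_real_derivative g' s) (at s)"
      by blast
    have "((deriv ^^ n) h has_real_derivative g' s) (at s)" if "s \<in> I" for s
      by (rule has_field_derivative_transform_within_open[OF _ assms(1) that]) (use g g' that in auto)
    with g' show ?case by (auto intro!: bexI[of _ g'] DERIV_imp_deriv)
  qed (use assms in auto)
  have "(deriv ^^ n) h differentiable_on I" for n
  proof -
    obtain g where g: "g \<in> \<A>" "\<forall>s\<in>I. (deriv ^^ n) h s = g s" using * by blast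
    from closed[OF g(1)] obtain g' where g': "\<forall>s\<in>I. (g has_real_derivative g' s) (at s)" by blast
    have "((deriv ^^ n) h has_real_derivative g' s) (at s)" if "s \<in> I" for s
      by (rule has_field_derivative_transform_within_open[OF _ assms(1) that]) (use g g' that in auto)
    then show ?thesis
      by (meson differentiable_at_imp_differentiable_on real_differentiable_def)
  qed
  with assms(1) show ?thesis by (simp add: smooth_on_open_def)
qed

inductive_set function_algebra :: "(real \<Rightarrow> real) set \<Rightarrow> (real \<Rightarrow> real) set"
  for B :: "(real \<Rightarrow> real) set" where
  base: "h \<in> B \<Longrightarrow> h \<in> function_algebra B"
| const: "(\<lambda>_. c) \<in> function_algebra B"
| add: "h \<in> function_algebra B \<Longrightarrow> k \<in> function_algebra B \<Longrightarrow> (\<lambda>s. h s + k s) \<in> function_algebra B"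
| mult: "h \<in> function_algebra B \<Longrightarrow> k \<in> function_algebra B \<Longrightarrow> (\<lambda>s. h s * k s) \<in> function_algebra B"

text \<open>The sum and product rules carry closure under differentiation from the generators to the
  whole algebra, so only finitely many derivatives need checking when \<open>B\<close> is
  finite.\<close>

lemma smooth_on_open_function_algebra:
  assumes "open I" "h \<in> function_algebra B"
    and base: "\<And>h. h \<in> B \<Longrightarrow> \<exists>h'\<in>function_algebra B. \<forall>s\<in>I. (h has_real_derivative h' s) (at s)"
  shows "smooth_on_open I h"
proof (rule smooth_on_open_of_derivative_closed[OF assms(1,2)])
  fix h assume "h \<in> function_algebra B"
  then show "\<exists>h'\<in>function_algebra B. \<forall>s\<in>I. (h has_real_derivative h' s) (at s)"
  proof induction
    case (const c)
    have "(\<lambda>_. 0) \<in> function_algebra B" by (rule function_algebra.const)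
    then show ?case by (rule bexI[rotated], intro ballI DERIV_const)
  next
    case (add h k)
    then obtain h' k' where h: "h' \<in> function_algebra B" "\<forall>s\<in>I. (h has_real_derivative h' s) (at s)"
      and k: "k' \<in> function_algebra B" "\<forall>s\<in>I. (k has_real_derivative k' s) (at s)" by blast
    from h(1) k(1) have "(\<lambda>s. h' s + k' s) \<in> function_algebra B"
      by (rule function_algebra.add)
    then show ?case
      by (rule bexI[rotated], intro ballI DERIV_add) (use h k in blast)+
  next
    case (mult h k)
    then obtain h' k' where h: "h' \<in> function_algebra B" "\<forall>s\<in>I. (h has_real_derivative h' s) (at s)"
      and k: "k' \<in> function_algebra B" "\<forall>s\<in>I. (k has_real_derivative k' s) (at s)" by blast
    from h(1) k(1) mult.hyps have "(\<lambda>s. h' s * k s + k' s * h s) \<in> function_algebra B"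
      by (intro function_algebra.add function_algebra.mult)
    then show ?case
      by (rule bexI[rotated], intro ballI DERIV_mult) (use h k in blast)+
  qed (rule base)
qed

section \<open>Local existence by separation of variables\<close>

lemma implicit_relation_exists:
  fixes f d :: "real \<Rightarrow> real" and p c1 c2 c3 :: real
  assumes df: "\<And>s. (f has_real_derivative d s) (at s)"
    and dd: "\<And>s. (d has_real_derivative (3 * (f s)\<^sup>2 + p) / 2) (at s)"
    and f0: "f 0 \<noteq> 0" and c: "c1 \<noteq> c2"
  shows "\<exists>I \<psi>. implicit_relation f c1 c2 c3 I \<psi>"
proof -
  define G where "G t = - c1 + c2 * cos t + c3 * sin t" for t
  \<comment> \<open>Since \<open>G 0 = c2 - c1\<close>, this is half the size of \<open>G 0\<close>,
    and \<open>\<sigma>\<close> is its sign.\<close>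
  define e where "e = \<bar>c2 - c1\<bar> / 2"
  define \<sigma> where "\<sigma> = sgn (c2 - c1)"
  \<comment> \<open>Cutting off at \<open>e\<close> makes \<open>1 / g\<close> integrable across the zeros of \<open>G\<close>, so that its
    integral is invertible on all of the reals; near \<open>0\<close> the cut-off is not active.\<close>
  define g where "g t = max (\<bar>G t\<bar>) e" for t
  define A where "A = (\<lambda>u. THE x. (LBINT t=ereal 0..ereal x. 1 / g t) = u)"
  have e: "0 < e" using c by (simp add: e_def)
  have "continuous_on UNIV g"
    unfolding g_def[abs_def] G_def by (intro continuous_intros)
  moreover have "0 < g t" for t using e by (auto simp: g_def)
  moreover have "g t \<le> \<bar>c1\<bar> + \<bar>c2\<bar> + \<bar>c3\<bar> + e" for t
  proof -
    have "\<bar>c2 * cos t\<bar> \<le> \<bar>c2\<bar>" "\<bar>c3 * sin t\<bar> \<le> \<bar>c3\<bar>"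
      by (simp_all add: abs_mult mult_left_le)
    then show ?thesis using e by (simp add: g_def G_def)
  qed
  ultimately have A0: "A 0 = 0" and dA: "\<And>u. (A has_real_derivative g (A u)) (at u)"
    using inverse_integral_DERIV unfolding A_def by blast+
  have contf: "isCont f s" for s using df DERIV_isCont by blast
  have "eventually (\<lambda>s. f s \<noteq> 0) (nhds 0)"
    using contf[of 0] f0 by (simp add: continuous_within tendsto_at_iff_tendsto_nhds tendsto_imp_eventually_ne)
  then obtain r where r: "0 < r" "\<And>s. \<bar>s\<bar> < r \<Longrightarrow> f s \<noteq> 0"
    by (auto simp: eventually_nhds_metric dist_real_def)
  define K where "K s = (LBINT t=ereal 0..ereal s. 1 / f t)" for s
  \<comment> \<open>The future theta. As A' = g(A), the chain rule gives h' = \<sigma> g(h) / f,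
    which equals G(h) / f wherever \<open>\<sigma> * G (h s) > e\<close>.\<close>
  define h where "h s = A (\<sigma> * K s)" for s
  have dK: "(K has_real_derivative 1 / f s) (at s)" if "\<bar>s\<bar> < r" for s
    unfolding K_def[abs_def]
    by (rule interval_integral_has_real_derivative[where I = "{-r<..<r}"])
       (use that r contf in \<open>auto intro!: continuous_intros continuous_at_imp_continuous_on simp: is_interval_1\<close>)
  have dh: "(h has_real_derivative g (h s) * (\<sigma> / f s)) (at s)" if "\<bar>s\<bar> < r" for s
    unfolding h_def
    by (rule DERIV_chain2[OF dA]) (auto intro!: derivative_eq_intros dK that)
  have h0: "h 0 = 0" by (simp add: h_def K_def A0)
  \<comment> \<open>At 0 the value is \<open>\<bar>c2 - c1\<bar>\<close>, twice \<open>e\<close>, so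
    continuity keeps the cut-off inactive on a neighbourhood.\<close>
  have "isCont (\<lambda>s. \<sigma> * G (h s)) 0"
    unfolding G_def using DERIV_isCont[OF dh[of 0]] r by (intro continuous_intros) auto
  moreover have "\<sigma> * G (h 0) > e"
    using c by (simp add: h0 G_def \<sigma>_def e_def sgn_if)
  ultimately have "eventually (\<lambda>s. \<sigma> * G (h s) > e) (nhds 0)"
    by (auto simp: isCont_def eventually_nhds_conv_at intro: order_tendstoD(1))
  then obtain r' where r': "0 < r'" "\<And>s. \<bar>s\<bar> < r' \<Longrightarrow> \<sigma> * G (h s) > e"
    by (auto simp: eventually_nhds_metric dist_real_def)
  define I where "I = {- min r r'<..<min r r'}"
  have I: "open I" "is_interval I" "0 \<in> I" using r(1) r'(1) by (auto simp: I_def is_interval_1)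
  have fnz: "f s \<noteq> 0" and Gnz: "G (h s) \<noteq> 0" and dhG: "(h has_real_derivative G (h s) / f s) (at s)"
    if "s \<in> I" for s
  proof -
    from that have s: "\<bar>s\<bar> < r" "\<bar>s\<bar> < r'" by (auto simp: I_def)
    show "f s \<noteq> 0" using r s by blast
    show "G (h s) \<noteq> 0" using r'(2)[OF s(2)] e by auto
    have "g (h s) * \<sigma> = G (h s)"
      using r'(2)[OF s(2)] e c by (auto simp: g_def \<sigma>_def sgn_if max_def split: if_splits)
    then show "(h has_real_derivative G (h s) / f s) (at s)"
      using dh[OF s(1)] by simp
  qed
  define \<psi> where "\<psi> s = f s * (1 / G (h s))" for s
  \<comment> \<open>On \<open>I\<close> the derivative of each generator is a polynomial in the
    generators. Reciprocals are included because the algebra has no division; \<open>h\<close>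
    itself may be left out, as h' = G(h) / f is already in the algebra.\<close>
  define B where "B = {f, d, \<lambda>s. 1 / f s, \<lambda>s. sin (h s), \<lambda>s. cos (h s), \<lambda>s. 1 / G (h s)}"
  have B: "f \<in> function_algebra B" "d \<in> function_algebra B" "(\<lambda>s. 1 / f s) \<in> function_algebra B"
    "(\<lambda>s. sin (h s)) \<in> function_algebra B" "(\<lambda>s. cos (h s)) \<in> function_algebra B"
    "(\<lambda>s. 1 / G (h s)) \<in> function_algebra B"
    by (auto intro: function_algebra.base simp: B_def)
  note alg = B function_algebra.add function_algebra.mult function_algebra.const
  have GB: "(\<lambda>s. G (h s)) \<in> function_algebra B"
    unfolding G_def by (intro alg)
  have derivI: "\<exists>k'\<in>function_algebra B. \<forall>s\<in>I. (k has_real_derivative k' s) (at s)"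
    if "k' \<in> function_algebra B" "\<And>s. s \<in> I \<Longrightarrow> (k has_real_derivative k' s) (at s)" for k k'
    using that by blast
  have "smooth_on_open I \<psi>"
  proof (rule smooth_on_open_function_algebra[OF I(1)])
    show "\<psi> \<in> function_algebra B"
      unfolding \<psi>_def[abs_def] by (intro alg)
    fix k assume "k \<in> B"
    then consider "k = f" | "k = d" | "k = (\<lambda>s. 1 / f s)" | "k = (\<lambda>s. sin (h s))"
      | "k = (\<lambda>s. cos (h s))" | "k = (\<lambda>s. 1 / G (h s))" unfolding B_def by blast
    then show "\<exists>k'\<in>function_algebra B. \<forall>s\<in>I. (k has_real_derivative k' s) (at s)"
    proof cases
      case 1
      show ?thesis unfolding 1 by (rule derivI[OF B(2) df])
    next
      case 2
      have "(\<lambda>s. (3 / 2) * (f s * f s) + p / 2) \<in> function_algebra B" by (intro alg)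
      moreover have "(k has_real_derivative (3 / 2) * (f s * f s) + p / 2) (at s)" if "s \<in> I" for s
        using dd[of s] 2 by (simp add: power2_eq_square field_simps)
      ultimately show ?thesis by (rule derivI)
    next
      case 3
      have "(\<lambda>s. (- 1) * (d s * ((1 / f s) * (1 / f s)))) \<in> function_algebra B" by (intro alg)
      moreover have "(k has_real_derivative (- 1) * (d s * ((1 / f s) * (1 / f s)))) (at s)" if "s \<in> I" for s
        unfolding 3 by (rule derivative_eq_intros df refl fnz that)+ simp
      ultimately show ?thesis by (rule derivI)
    next
      case 4
      have "(\<lambda>s. cos (h s) * (G (h s) * (1 / f s))) \<in> function_algebra B" by (intro alg GB)
      moreover have "(k has_real_derivative cos (h s) * (G (h s) * (1 / f s))) (at s)" if "s \<in> I" for s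
        unfolding 4 by (rule derivative_eq_intros dhG that refl)+ simp
      ultimately show ?thesis by (rule derivI)
    next
      case 5
      have "(\<lambda>s. (- 1) * (sin (h s) * (G (h s) * (1 / f s)))) \<in> function_algebra B" by (intro alg GB)
      moreover have "(k has_real_derivative (- 1) * (sin (h s) * (G (h s) * (1 / f s)))) (at s)" if "s \<in> I" for s
        unfolding 5 by (rule derivative_eq_intros dhG that refl)+ simp
      ultimately show ?thesis by (rule derivI)
    next
      case 6
      \<comment> \<open>One factor G(h) from h' cancels against the squared denominator.\<close>
      have "(\<lambda>s. (c2 * sin (h s) + (- c3) * cos (h s)) * ((1 / f s) * (1 / G (h s)))) \<in> function_algebra B"
        by (intro alg)
      moreover have "(k has_real_derivative (c2 * sin (h s) + (- c3) * cos (h s)) * ((1 / f s) * (1 / G (h s)))) (at s)"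
        if "s \<in> I" for s
      proof -
        have "((\<lambda>s. G (h s)) has_real_derivative (- c2 * sin (h s) + c3 * cos (h s)) * (G (h s) / f s)) (at s)"
        proof (rule DERIV_chain2[OF _ dhG[OF that]])
          show "(G has_real_derivative - c2 * sin t + c3 * cos t) (at t)" for t
            unfolding G_def[abs_def] by (rule derivative_eq_intros refl | simp)+
        qed
        from DERIV_inverse_fun[OF this Gnz[OF that]] show ?thesis
          using Gnz[OF that] fnz[OF that] unfolding 6
          by (simp add: inverse_eq_divide) (simp add: field_simps minus_divide_left)
      qed
      ultimately show ?thesis by (rule derivI)
    qed
  qed
  moreover have "\<psi> s \<noteq> 0" if "s \<in> I" for s
    using fnz Gnz that by (simp add: \<psi>_def)
  \<comment> \<open>This closes the implicit circle: \<open>1 / \<psi>\<close> is G(h) / f, the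
    derivative of \<open>h\<close>, so the integral defining theta returns \<open>h\<close>.\<close>
  moreover have \<theta>: "theta \<psi> s = h s" if "s \<in> I" for s
  proof -
    have sub: "{min 0 s..max 0 s} \<subseteq> I"
      using I that by (auto simp: I_def)
    have "(LBINT t=ereal 0..ereal s. 1 / \<psi> t) = h s - h 0"
    proof (rule interval_integral_FTC_finite)
      show "(h has_vector_derivative 1 / \<psi> t) (at t within {min 0 s..max 0 s})"
        if "min 0 s \<le> t" "t \<le> max 0 s" for t
      proof -
        have "t \<in> I" using that sub by (meson atLeastAtMost_iff subsetD)
        from DERIV_subset[OF dhG[OF this], of "{min 0 s..max 0 s}"] show ?thesis
          by (simp add: \<psi>_def has_real_derivative_iff_has_vector_derivative)
      qed
      have "isCont (\<lambda>t. 1 / \<psi> t) t" if "t \<in> I" for t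
        unfolding \<psi>_def G_def using DERIV_isCont[OF dhG[OF that]] contf[of t] fnz[OF that] Gnz[OF that]
        by (intro continuous_intros) (auto simp: G_def)
      then show "continuous_on {min 0 s..max 0 s} (\<lambda>t. 1 / \<psi> t)"
        using sub by (intro continuous_at_imp_continuous_on) blast
    qed
    then show ?thesis by (simp add: theta_def h0)
  qed
  moreover have "G (theta \<psi> s) * \<psi> s = f s" if "s \<in> I" for s
    using Gnz[OF that] by (simp add: \<theta>[OF that]) (simp add: \<psi>_def)
  ultimately have "implicit_relation f c1 c2 c3 I \<psi>"
    using I by (simp add: implicit_relation_def G_def)
  then show ?thesis by blast
qed

text \<open>The second conjunct shows that the first is not vacuous. At s = 0 theta vanishes and the
  potential equals x1 < 0, so the relation reads (c2 - c1) \<psi>(0) = x1; it can hold only if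
  \<open>c1 \<noteq> c2\<close>, and this condition also suffices locally.\<close>

theorem theorem1p4:
  fixes x1 x2 x3 c1 c2 c3 :: real
  assumes "x1 < x2" and "x2 < x3" and "x1 + x2 + x3 = 0"
    and "- c1\<^sup>2 + c2\<^sup>2 + c3\<^sup>2 = - x1 * x2 * x3"
  shows "(\<forall>I \<psi>. implicit_relation (sn_potential x1 x2 x3) c1 c2 c3 I \<psi> \<longrightarrow>
             solves_ode_on (sn_potential x1 x2 x3) I \<psi>) \<and>
         (c1 \<noteq> c2 \<longrightarrow>
             (\<exists>I \<psi>. implicit_relation (sn_potential x1 x2 x3) c1 c2 c3 I \<psi> \<and>
                solves_ode_on (sn_potential x1 x2 x3) I \<psi>))"
proof -
  define f where "f = sn_potential x1 x2 x3"
  define p where "p = x1 * x2 + x2 * x3 + x3 * x1"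
  obtain d where d: "\<And>s. (f has_real_derivative d s) (at s)"
    "\<And>s. (d has_real_derivative (3 * (f s)\<^sup>2 + p) / 2) (at s)"
    "\<And>s. (d s)\<^sup>2 = (f s)^3 + p * f s - x1 * x2 * x3" "f 0 = x1"
    using sn_potential_DERIV[OF assms(1-3)] unfolding f_def p_def by blast
  have x1: "x1 < 0" using assms by linarith
  \<comment> \<open>With zero sum, \<open>p\<close> is minus half the sum of the squares, hence
    negative.\<close>
  have "2 * p = (x1 + x2 + x3)\<^sup>2 - (x1\<^sup>2 + x2\<^sup>2 + x3\<^sup>2)"
    by (simp add: p_def power2_eq_square algebra_simps)
  moreover have "0 < x1\<^sup>2 + x2\<^sup>2 + x3\<^sup>2"
    using x1 by (intro add_pos_nonneg) auto
  ultimately have p: "p \<noteq> 0"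
    using assms(3) by simp
  have c: "- c1\<^sup>2 + c2\<^sup>2 + c3\<^sup>2 = - (x1 * x2 * x3)"
    using assms(4) by simp
  have "solves_ode_on f I \<psi>" if "implicit_relation f c1 c2 c3 I \<psi>" for I \<psi>
    using implicit_relation_imp_solves_ode[OF d(1-3) p c that] .
  moreover have "\<exists>I \<psi>. implicit_relation f c1 c2 c3 I \<psi>" if "c1 \<noteq> c2"
    using implicit_relation_exists[OF d(1,2) _ that] d(4) x1 by simp
  ultimately show ?thesis unfolding f_def by blast
qed

end
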